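(* Let $m,n$ be positive integers. The polytope $P(m,n)$ has exactly $3mn-n-2(m-1)$ facets.
   Context: A sign matrix is a matrix with entries in $\{-1,0,1\}$ all of whose column partial sums from the top $\sum_{i'=1}^{i}M_{i'j}$ lie in $\{0,1\}$ and all of whose row partial sums from the left $\sum_{j'=1}^{j}M_{ij'}$ are nonnegative. $P(m,n)$ is the convex hull in $\mathbb{R}^{mn}$ of all $m\times n$ sign matrices. *)

theory Defs
  imports "HOL-Analysis.Analysis"
begin

text \<open>An $m \times n$ matrix has type \<open>real ^ 'n ^ 'm\<close>, with \<open>M $ i $ j\<close> the entry in row \<open>i\<close> and
  column \<open>j\<close>. The index types are linearly ordered, so that \<open>{..i}\<close> is the initial segment of
  row indices from the top up to \<open>i\<close>, and \<open>{..j}\<close> that of column indices from the left up to \<open>j\<close>;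
  a finite linear order with \<open>CARD('m) = m\<close> elements is $1 < \dots < m$ up to renaming.\<close>

definition sign_matrix :: "real ^ 'n::{finite,linorder} ^ 'm::{finite,linorder} \<Rightarrow> bool" where
  "sign_matrix M \<longleftrightarrow>
     (\<forall>i j. M $ i $ j \<in> {-1, 0, 1}) \<and>
     (\<forall>i j. (\<Sum>i'\<in>{..i}. M $ i' $ j) \<in> {0, 1}) \<and>
     (\<forall>i j. 0 \<le> (\<Sum>j'\<in>{..j}. M $ i $ j'))"

definition sign_matrix_polytope :: "(real ^ 'n::{finite,linorder} ^ 'm::{finite,linorder}) set" where
  "sign_matrix_polytope = convex hull {M. sign_matrix M}"

end

theory Submission
  imports Defs
begin

text \<open>The polytope is cut out by the inequalities $0 \le C_{ij} \le 1$ and $R_{ij} \ge 0$ for the column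
  partial sums $C$ and row partial sums $R$. In terms of the double partial sums $S_{ij}$ every one of
  these inequalities bounds a single $S_{ij}$, or a difference of two of them, by an integer; moving
  all $S_{ij}$ with one common non-zero fractional part by the same small amount, up or down, therefore
  keeps a point feasible, and so extreme points are integral, that is, sign matrices.

  The facets correspond to the inequalities that remain after discarding the redundant ones:
  $R_{1j} \ge 0$, the lower bounds $C_{i1} \ge 0$ with $i > 1$ and the upper bounds $C_{i1} \le 1$ with
  $i < m$. The rest is irredundant because each remaining inequality is violated by a point that
  satisfies all the others, which gives $(m-1)n + 2(m(n-1)+1)$ facets.\<close>

section \<open>Facets of a polyhedron given by an irredundant system\<close>

text \<open>The point \<open>z\<close> makes the polyhedron full-dimensional and the points
  \<open>w\<close> make the system irredundant, so its facets are exactly the intersections with the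
  bounding hyperplanes. Different indices give different facets, since each facet contains a point
  at which every other inequality is strict.\<close>

lemma card_facets_irredundant:
  fixes f :: "'k \<Rightarrow> 'a::euclidean_space \<Rightarrow> real"
  assumes "finite K" and lin: "\<And>k. k \<in> K \<Longrightarrow> linear (f k)"
    and z: "\<And>k. k \<in> K \<Longrightarrow> f k z < b k"
    and w: "\<And>k. k \<in> K \<Longrightarrow> \<exists>w. b k < f k w \<and> (\<forall>l\<in>K - {k}. f l w \<le> b l)"
  shows "card {F. F facet_of {x. \<forall>k\<in>K. f k x \<le> b k}} = card K"
proof -
  define S where "S = {x. \<forall>k\<in>K. f k x \<le> b k}"
  \<comment> \<open>The normal vector representing the functional \<open>f k\<close>;
    \<open>facet_of_polyhedron_explicit\<close> speaks of half-spaces given by inner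
    products.\<close>
  define a where "a k = adjoint (f k) 1" for k
  have fa: "f k x = a k \<bullet> x" if "k \<in> K" for k x
    using adjoint_works[OF lin[OF that], of x 1] by (simp add: a_def inner_commute)
  define h where "h k = {x. a k \<bullet> x \<le> b k}" for k
  define g where "g k = S \<inter> {x. a k \<bullet> x = b k}" for k
  obtain w where w: "\<And>k. k \<in> K \<Longrightarrow> b k < a k \<bullet> w k"
      "\<And>k l. k \<in> K \<Longrightarrow> l \<in> K \<Longrightarrow> l \<noteq> k \<Longrightarrow> a l \<bullet> w k \<le> b l"
  proof -
    have "\<exists>w. \<forall>k\<in>K. b k < f k (w k) \<and> (\<forall>l\<in>K - {k}. f l (w k) \<le> b l)"
      using w by (intro bchoice) blast
    then obtain w where "\<forall>k\<in>K. b k < f k (w k) \<and> (\<forall>l\<in>K - {k}. f l (w k) \<le> b l)" ..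
    then show ?thesis using fa by (intro that[of w]) auto
  qed
  have z: "a k \<bullet> z < b k" if "k \<in> K" for k
    using z[OF that] fa[OF that] by simp
  have S: "S = \<Inter>(h ` K)"
    by (auto simp: S_def h_def fa)
  have inj_h: "inj_on h K"
  proof (rule inj_onI, rule ccontr)
    fix k l assume kl: "k \<in> K" "l \<in> K" "h k = h l" "k \<noteq> l"
    have "w k \<in> h l" "w k \<notin> h k"
      using w(1)[of k] w(2)[of k l] kl(1,2,4) by (auto simp: h_def)
    with kl(3) show False by simp
  qed
  have "open (\<Inter>k\<in>K. {x. a k \<bullet> x < b k})"
    using \<open>finite K\<close> by (intro open_INT) (auto intro: open_halfspace_lt)
  then have "z \<in> interior S"
    by (rule interiorI) (auto simp: S h_def z less_imp_le)
  then have hull: "affine hull S = UNIV"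
    by (intro affine_hull_nonempty_interior) auto
  \<comment> \<open>That result indexes facets by the half-spaces themselves, so the index
    \<open>k\<close> has to be recovered from \<open>h k\<close>; this is where \<open>inj_h\<close>
    enters.\<close>
  define ind where "ind = inv_into K h"
  have ind: "ind (h k) = k" if "k \<in> K" for k
    using inj_h that by (simp add: ind_def)
  have "F facet_of S \<longleftrightarrow> (\<exists>H. H \<in> h ` K \<and> F = S \<inter> {x. a (ind H) \<bullet> x = b (ind H)})" for F
  proof (rule facet_of_polyhedron_explicit)
    show "finite (h ` K)" using \<open>finite K\<close> by simp
    show "S = affine hull S \<inter> \<Inter>(h ` K)" by (subst hull) (simp add: S)
    show "a (ind H) \<noteq> 0 \<and> H = {x. a (ind H) \<bullet> x \<le> b (ind H)}" if H: "H \<in> h ` K" for H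
    proof -
      obtain k where k: "k \<in> K" "H = h k" using H by auto
      have "a k \<noteq> 0" using w(1)[OF k(1)] z[OF k(1)] by auto
      then show ?thesis using k by (simp add: ind) (simp add: h_def)
    qed
    show "S \<subset> affine hull S \<inter> \<Inter>F'" if F': "F' \<subset> h ` K" for F'
    proof -
      obtain k where k: "k \<in> K" "h k \<notin> F'" using F' by auto
      have "w k \<in> H" if H: "H \<in> F'" for H
      proof -
        obtain l where "l \<in> K" "H = h l" using F' H by auto
        then show ?thesis using w(2)[OF k(1), of l] k H by (auto simp: h_def)
      qed
      moreover have "w k \<notin> S" using w(1)[OF k(1)] k(1) by (auto simp: S h_def not_le)
      moreover have "S \<subseteq> \<Inter>F'" using F' S by auto
      ultimately show ?thesis unfolding hull by auto
    qed
  qed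
  then have "{F. F facet_of S} = g ` K"
    by (auto simp: ind g_def)
  moreover have "inj_on g K"
  proof (rule inj_onI, rule ccontr)
    fix k l assume kl: "k \<in> K" "l \<in> K" "g k = g l" "k \<noteq> l"
    \<comment> \<open>The segment from \<open>z\<close> to \<open>w k\<close> crosses the hyperplane of \<open>k\<close> strictly inside all others.\<close>
    define t where "t = (b k - a k \<bullet> z) / (a k \<bullet> w k - a k \<bullet> z)"
    have t: "0 < t" "t < 1"
      using z[OF kl(1)] w(1)[OF kl(1)] by (auto simp: t_def divide_simps)
    define p where "p = (1 - t) *\<^sub>R z + t *\<^sub>R w k"
    have "a k \<bullet> p = a k \<bullet> z + t * (a k \<bullet> w k - a k \<bullet> z)"
      by (simp add: p_def inner_add_right algebra_simps)
    also have "\<dots> = b k"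
      using z[OF kl(1)] w(1)[OF kl(1)] by (simp add: t_def)
    finally have pk: "a k \<bullet> p = b k" .
    have pl: "a j \<bullet> p < b j" if "j \<in> K" "j \<noteq> k" for j
    proof -
      have "(1 - t) * (a j \<bullet> z) + t * (a j \<bullet> w k) < (1 - t) * b j + t * b j"
        using z[OF that(1)] w(2)[OF kl(1) that] t by (intro add_less_le_mono) auto
      then show ?thesis by (simp add: p_def inner_add_right algebra_simps)
    qed
    have "p \<in> g k"
      using pk pl by (force simp: g_def S_def fa)
    moreover have "p \<notin> g l"
      using kl(2,4) pl[of l] by (auto simp: g_def)
    ultimately show False
      using kl(3) by simp
  qed
  ultimately show ?thesis
    by (simp add: S_def card_image)
qed

section \<open>Partial sums over a finite linear order\<close>

definition col_sum :: "real ^ 'n::{finite,linorder} ^ 'm::{finite,linorder} \<Rightarrow> 'm \<Rightarrow> 'n \<Rightarrow> real" where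
  "col_sum M i j = (\<Sum>i'\<in>{..i}. M $ i' $ j)"

definition row_sum :: "real ^ 'n::{finite,linorder} ^ 'm::{finite,linorder} \<Rightarrow> 'm \<Rightarrow> 'n \<Rightarrow> real" where
  "row_sum M i j = (\<Sum>j'\<in>{..j}. M $ i $ j')"

lemma linear_col_sum: "linear (\<lambda>M. col_sum M i j)"
  by (rule linearI) (simp_all add: col_sum_def sum.distrib sum_distrib_left)

lemma linear_row_sum: "linear (\<lambda>M. row_sum M i j)"
  by (rule linearI) (simp_all add: row_sum_def sum.distrib sum_distrib_left)

text \<open>Stands in for the predecessor of \<open>i\<close>: a property of all sums over
  \<open>{..p}\<close> passes to the sum over \<open>{..<i}\<close> once the empty sum is
  treated.\<close>

lemma lessThan_finite_linorder:
  fixes i :: "'a::{finite,linorder}"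
  shows "{..<i} = {} \<or> (\<exists>p<i. {..<i} = {..p})"
proof (cases "{..<i} = {}")
  case False
  have p: "Max {..<i} < i"
    using Max_in[of "{..<i}"] False by simp
  have "{..<i} = {..Max {..<i}}"
    using p by (auto intro: Max_ge)
  with p show ?thesis by blast
qed simp

lemma sum_atMost_split:
  fixes i :: "'a::{finite,linorder}" and g :: "'a \<Rightarrow> real"
  shows "(\<Sum>k\<in>{..i}. g k) = g i + (\<Sum>k\<in>{..<i}. g k)"
  by (simp flip: ivl_disj_un_singleton(2))

text \<open>Differences of consecutive values of \<open>G\<close> do it, by induction on the number
  of smaller indices.\<close>

lemma ex_prefix_sums:
  fixes G :: "'a::{finite,linorder} \<Rightarrow> real"
  shows "\<exists>g. \<forall>i. (\<Sum>k\<in>{..i}. g k) = G i"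
proof -
  \<comment> \<open>\<open>Max {..<i}\<close> is the predecessor of \<open>i\<close>; before the
    first index the value is taken to be 0.\<close>
  define g where "g i = G i - (if {..<i} = {} then 0 else G (Max {..<i}))" for i
  have "(\<Sum>k\<in>{..i}. g k) = G i" for i
  proof (induction "card {..<i}" arbitrary: i rule: less_induct)
    case less
    consider "{..<i} = {}" | p where "p < i" "{..<i} = {..p}"
      using lessThan_finite_linorder by blast
    then show ?case
    proof cases
      case 1
      then have "g i = G i" unfolding g_def by simp
      then show ?thesis unfolding sum_atMost_split[of g i] 1 by simp
    next
      case 2
      have "card {..<p} < card {..<i}"
        using 2(1) by (intro psubset_card_mono) auto
      then have "(\<Sum>k\<in>{..p}. g k) = G p" by (rule less)
      moreover have "Max {..p} = p" by (intro Max_eqI) auto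
      ultimately have "g i = G i - G p"
        unfolding g_def 2(2) by auto
      then show ?thesis
        unfolding sum_atMost_split[of g i] 2(2) \<open>(\<Sum>k\<in>{..p}. g k) = G p\<close> by simp
    qed
  qed
  then show ?thesis by blast
qed

text \<open>An integral increment \<open>g i\<close> does not change the value of the 1-periodic
  function \<open>h\<close>, so the sums of \<open>g'\<close> agree before and after
  \<open>i\<close>. The condition \<open>h 0 = 0\<close> covers the first index, where the preceding
  sum is empty.\<close>

lemma prefix_sum_no_jump:
  fixes g g' :: "'a::{finite,linorder} \<Rightarrow> real"
  assumes h: "h 0 = 0" "\<And>s t. s - t \<in> \<int> \<Longrightarrow> h s = h t"
    and g': "\<And>i. (\<Sum>k\<in>{..i}. g' k) = h (\<Sum>k\<in>{..i}. g k)"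
    and "g i \<in> \<int>"
  shows "g' i = 0"
proof -
  have "(\<Sum>k\<in>{..<i}. g' k) = h (\<Sum>k\<in>{..<i}. g k)"
    using lessThan_finite_linorder[of i] h(1) g' by auto
  moreover have "h (\<Sum>k\<in>{..i}. g k) = h (\<Sum>k\<in>{..<i}. g k)"
    using \<open>g i \<in> \<int>\<close> by (intro h(2)) (simp add: sum_atMost_split)
  ultimately show ?thesis
    using g'[of i] by (simp add: sum_atMost_split)
qed

lemma prefix_sum_Ints:
  fixes g :: "'a::{finite,linorder} \<Rightarrow> real"
  assumes "\<And>i. (\<Sum>k\<in>{..i}. g k) \<in> \<int>"
  shows "g i \<in> \<int>"
proof -
  have "(\<Sum>k\<in>{..<i}. g k) \<in> \<int>"
    using lessThan_finite_linorder[of i] assms by auto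
  then have "(\<Sum>k\<in>{..i}. g k) - (\<Sum>k\<in>{..<i}. g k) \<in> \<int>"
    using assms by (intro Ints_diff)
  then show ?thesis by (simp add: sum_atMost_split)
qed

text \<open>A strict inequality survives small perturbations by continuity; a tight one survives
  because the direction leaves it unchanged.\<close>

lemma eventually_perturb_nonneg:
  fixes c d :: real
  assumes "0 \<le> c" "c = 0 \<Longrightarrow> d = 0"
  shows "\<forall>\<^sub>F e in nhds 0. 0 \<le> c + e * d"
proof (cases "c = 0")
  case True then show ?thesis using assms by simp
next
  case False
  have "((\<lambda>e. c + e * d) \<longlongrightarrow> c + 0 * d) (nhds 0)"
    by (intro tendsto_intros filterlim_ident)
  then have "\<forall>\<^sub>F e in nhds 0. 0 < c + e * d"
    using False assms(1) by (intro order_tendstoD) auto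
  then show ?thesis by eventually_elim simp
qed

section \<open>The inequality description and integrality of extreme points\<close>

definition sign_region :: "(real ^ 'n::{finite,linorder} ^ 'm::{finite,linorder}) set" where
  "sign_region = {M. \<forall>i j. 0 \<le> col_sum M i j \<and> col_sum M i j \<le> 1 \<and> 0 \<le> row_sum M i j}"

text \<open>Makes row sums and column sums both differences of the same double partial sums, in the
  two directions.\<close>

lemma sum_row_sum: "(\<Sum>i'\<in>{..i}. row_sum M i' j) = (\<Sum>j'\<in>{..j}. col_sum M i j')"
  unfolding row_sum_def col_sum_def by (rule sum.swap)

text \<open>An entry is the difference of two consecutive column partial sums, or the first of them,
  so values in \<open>{0, 1}\<close> for these force the entry into
  \<open>{-1, 0, 1}\<close>.\<close>

lemma sign_matrix_iff:
  "sign_matrix M \<longleftrightarrow> (\<forall>i j. col_sum M i j \<in> {0, 1} \<and> 0 \<le> row_sum M i j)"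
proof -
  have "M $ i $ j \<in> {-1, 0, 1}" if C: "\<And>i j. col_sum M i j \<in> {0, 1}" for i j
  proof -
    have "(\<Sum>i'\<in>{..<i}. M $ i' $ j) \<in> {0, 1}"
      using lessThan_finite_linorder[of i] C unfolding col_sum_def
      by (elim disjE exE conjE) (simp, simp only:)
    then show ?thesis
      using C[of i j] by (auto simp: col_sum_def sum_atMost_split)
  qed
  then show ?thesis
    unfolding sign_matrix_def col_sum_def row_sum_def by blast
qed

lemma convex_sign_region: "convex sign_region"
proof -
  have "sign_region = (\<Inter>i j. (\<lambda>M. col_sum M i j) -` {0..1} \<inter> (\<lambda>M. row_sum M i j) -` {0..})"
    by (auto simp: sign_region_def)
  also have "convex \<dots>"
    by (intro convex_INT convex_Int convex_linear_vimage linear_col_sum linear_row_sum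
        convex_real_interval)
  finally show ?thesis .
qed

text \<open>Boundedness comes from the column sums alone: an entry is a difference of two numbers
  between 0 and 1.\<close>

lemma compact_sign_region:
  "compact (sign_region :: (real ^ 'n::{finite,linorder} ^ 'm::{finite,linorder}) set)"
proof -
  let ?Q = "sign_region :: (real ^ 'n::{finite,linorder} ^ 'm::{finite,linorder}) set"
  have "?Q = (\<Inter>i j. (\<lambda>M. col_sum M i j) -` {0..1} \<inter> (\<lambda>M. row_sum M i j) -` {0..})"
    by (auto simp: sign_region_def)
  moreover have "closed \<dots>"
    unfolding col_sum_def row_sum_def
    by (intro closed_INT ballI closed_Int closed_vimage closed_atLeastAtMost closed_atLeast
        continuous_intros)
  ultimately have "closed ?Q" by simp
  moreover have "bounded ?Q"
  proof (rule boundedI)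
    fix M :: "real ^ 'n::{finite,linorder} ^ 'm::{finite,linorder}" assume M: "M \<in> ?Q"
    have "\<bar>M $ i $ j\<bar> \<le> 1" for i j
    proof -
      have C: "0 \<le> col_sum M k j \<and> col_sum M k j \<le> 1" for k
        using M by (simp add: sign_region_def)
      have "0 \<le> (\<Sum>i'\<in>{..<i}. M $ i' $ j) \<and> (\<Sum>i'\<in>{..<i}. M $ i' $ j) \<le> 1"
        using lessThan_finite_linorder[of i] C by (auto simp: col_sum_def)
      then show ?thesis
        using C[of i] unfolding col_sum_def sum_atMost_split by linarith
    qed
    then have "norm (M $ i) \<le> (\<Sum>j\<in>(UNIV :: 'n::{finite,linorder} set). 1)" for i
      by (intro order_trans[OF norm_le_l1_cart] sum_mono)
    then show "norm M \<le> (\<Sum>i\<in>(UNIV :: 'm::{finite,linorder} set). \<Sum>j\<in>(UNIV :: 'n::{finite,linorder} set). 1)"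
      unfolding norm_vec_def[of M] by (intro order_trans[OF L2_set_le_sum] sum_mono) auto
  qed
  ultimately show ?thesis by (simp add: compact_eq_bounded_closed)
qed

lemma extreme_point_sign_region:
  fixes x :: "real ^ 'n::{finite,linorder} ^ 'm::{finite,linorder}"
  assumes ext: "x extreme_point_of sign_region"
  shows "sign_matrix x"
proof -
  define S where "S M i j = (\<Sum>j'\<in>{..j}. col_sum M i j')" for M :: "real ^ 'n::{finite,linorder} ^ 'm::{finite,linorder}" and i j
  have x: "0 \<le> col_sum x i j" "col_sum x i j \<le> 1" "0 \<le> row_sum x i j" for i j
    using ext by (auto simp: extreme_point_of_def sign_region_def)
  have "S x i0 j0 \<in> \<int>" for i0 j0
  proof (rule ccontr)
    assume nonint: "S x i0 j0 \<notin> \<int>"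
    \<comment> \<open>Indicator of the class of \<open>S x i0 j0\<close> modulo 1: it selects the
      double sums that are moved together.\<close>
    define h :: "real \<Rightarrow> real" where "h s = (if frac s = frac (S x i0 j0) then 1 else 0)" for s
    have "frac (S x i0 j0) \<noteq> 0"
      using nonint by (simp add: frac_eq_0_iff)
    then have h0: "h 0 = 0"
      by (simp add: h_def)
    have hI: "h s = h t" if st: "s - t \<in> \<int>" for s t
    proof -
      obtain k where "s - t = of_int k" using st by (rule Ints_cases)
      then have "s = t + of_int k" by simp
      then have "frac s = frac t" by (simp add: frac_def)
      then show ?thesis by (simp add: h_def)
    qed
    \<comment> \<open>Differencing \<open>h (S x i j)\<close> first in \<open>j\<close> and then in
      \<open>i\<close> yields a matrix \<open>D\<close> having these values as its double partial
      sums.\<close>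
    have "\<exists>e. \<forall>j. (\<Sum>j'\<in>{..j}. e j') = h (S x i j)" for i
      by (rule ex_prefix_sums)
    then obtain e where e: "\<And>i j. (\<Sum>j'\<in>{..j}. e i j') = h (S x i j)" by metis
    have "\<exists>d. \<forall>i. (\<Sum>i'\<in>{..i}. d i') = e i j" for j
      by (rule ex_prefix_sums)
    then obtain d where d: "\<And>i j. (\<Sum>i'\<in>{..i}. d j i') = e i j" by metis
    define D where "D = (\<chi> i j. d j i)"
    have CD: "col_sum D i j = e i j" for i j by (simp add: col_sum_def D_def d)
    have SD: "S D i j = h (S x i j)" for i j by (simp add: S_def CD e)
    \<comment> \<open>A column sum of \<open>x\<close> is the increment of \<open>S x i\<close> at
      \<open>j\<close>; if it is integral, both ends of the increment are moved or neither
      is.\<close>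
    have colD: "col_sum D i j = 0" if "col_sum x i j \<in> \<int>" for i j
      by (rule prefix_sum_no_jump[where h = h and g = "col_sum x i" and i = j, OF h0 hI _ that]) (use SD in \<open>simp_all add: S_def\<close>)
    \<comment> \<open>The same argument in the other direction: by \<open>sum_row_sum\<close>, for
      fixed \<open>j\<close> the double sums are prefix sums over \<open>i\<close> of the row
      sums.\<close>
    have rowD: "row_sum D i j = 0" if "row_sum x i j \<in> \<int>" for i j
      by (rule prefix_sum_no_jump[where h = h and g = "\<lambda>i. row_sum x i j" and g' = "\<lambda>i. row_sum D i j" and i = i,
            OF h0 hI _ that])
        (use SD in \<open>simp_all add: S_def sum_row_sum\<close>)
    \<comment> \<open>All bounds are integers, so a bound is tight only at an integral sum, where
      \<open>colD\<close> or \<open>rowD\<close> makes the change vanish.\<close>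
    have "\<forall>\<^sub>F t in nhds 0. \<forall>i j. 0 \<le> col_sum x i j + t * col_sum D i j"
      by (intro eventually_all_finite eventually_perturb_nonneg) (auto simp: x colD)
    moreover have "\<forall>\<^sub>F t in nhds 0. \<forall>i j. 0 \<le> (1 - col_sum x i j) + t * (- col_sum D i j)"
    proof (intro eventually_all_finite eventually_perturb_nonneg)
      fix i j
      assume "1 - col_sum x i j = 0"
      then have "col_sum x i j = 1" by simp
      then show "- col_sum D i j = 0" using colD[of i j] by simp
    qed (simp add: x)
    moreover have "\<forall>\<^sub>F t in nhds 0. \<forall>i j. 0 \<le> row_sum x i j + t * row_sum D i j"
      by (intro eventually_all_finite eventually_perturb_nonneg) (auto simp: x rowD)
    ultimately have "\<forall>\<^sub>F t in nhds 0. x + t *\<^sub>R D \<in> sign_region"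
      by eventually_elim
        (simp add: sign_region_def linear_add[OF linear_col_sum] linear_add[OF linear_row_sum]
          linear_scale[OF linear_col_sum] linear_scale[OF linear_row_sum] algebra_simps)
    then obtain r where r: "r > 0" "\<And>t. dist t 0 < r \<Longrightarrow> x + t *\<^sub>R D \<in> sign_region"
      by (auto simp: eventually_nhds_metric)
    define p q where "p = x + (r / 2) *\<^sub>R D" and "q = x - (r / 2) *\<^sub>R D"
    have pq: "p \<in> sign_region" "q \<in> sign_region"
      using r(1) r(2)[of "r / 2"] r(2)[of "- (r / 2)"] by (simp_all add: p_def q_def dist_real_def)
    \<comment> \<open>The left side is 1 by the choice of \<open>h\<close>, the right side 0; thus
      the perturbation is not trivial.\<close>
    have "S D i0 j0 \<noteq> S 0 i0 j0"
      unfolding SD by (simp add: h_def S_def col_sum_def)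
    then have "D \<noteq> 0" by auto
    moreover have "p - q = r *\<^sub>R D"
      by (simp add: p_def q_def flip: scaleR_add_left)
    ultimately have "p \<noteq> q" using r(1) by auto
    moreover have "midpoint p q = x"
      by (simp add: midpoint_def p_def q_def)
    ultimately have "x \<in> open_segment p q"
      using midpoint_in_open_segment[of p q] by simp
    then show False using ext pq by (auto simp: extreme_point_of_def)
  qed
  then have int_col: "col_sum x i j \<in> \<int>" for i j
    unfolding S_def by (rule prefix_sum_Ints)
  have "col_sum x i j \<in> {0, 1}" for i j
  proof -
    obtain k where k: "col_sum x i j = of_int k"
      using int_col by (rule Ints_cases)
    then have "0 \<le> k" "k \<le> 1" using x[of i j] by simp_all
    then have "k = 0 \<or> k = 1" by linarith
    then show ?thesis using k by auto
  qed
  then show ?thesis using x by (simp add: sign_matrix_iff)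
qed

text \<open>One inclusion holds because \<open>sign_region\<close> is convex and contains the sign
  matrices; the other is the Krein-Milman-Minkowski theorem, the extreme points being sign
  matrices.\<close>

lemma sign_matrix_polytope_eq: "sign_matrix_polytope = sign_region"
proof
  show "sign_matrix_polytope \<subseteq> sign_region"
    unfolding sign_matrix_polytope_def
  proof (rule hull_minimal, safe)
    fix M :: "real ^ 'n::{finite,linorder} ^ 'm::{finite,linorder}" assume "sign_matrix M"
    then have C: "col_sum M i j \<in> {0, 1}" and R: "0 \<le> row_sum M i j" for i j
      unfolding sign_matrix_iff by blast+
    have "0 \<le> col_sum M i j \<and> col_sum M i j \<le> 1" for i j
      using C[of i j] by auto
    then show "M \<in> sign_region"
      using R by (simp add: sign_region_def)
  next
    show "convex sign_region" by (rule convex_sign_region)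
  qed
  have "sign_region = convex hull {x. x extreme_point_of sign_region}"
    by (rule Krein_Milman_Minkowski[OF compact_sign_region convex_sign_region])
  also have "\<dots> \<subseteq> sign_matrix_polytope"
    unfolding sign_matrix_polytope_def by (rule hull_mono) (auto intro: extreme_point_sign_region)
  finally show "sign_region \<subseteq> sign_matrix_polytope" .
qed

section \<open>Points violating exactly one inequality\<close>

text \<open>Column \<open>j\<close> will carry the violation, while the first column supplies what
  keeps the row sums nonnegative.\<close>

definition two_column_matrix ::
  "'n \<Rightarrow> ('m \<Rightarrow> real) \<Rightarrow> ('m \<Rightarrow> real) \<Rightarrow> real ^ 'n::{finite,linorder} ^ 'm::{finite,linorder}" where
  "two_column_matrix j \<alpha> \<beta> =
     (\<chi> i' j'. (if j' = Min UNIV then \<alpha> i' else 0) + (if j' = j then \<beta> i' else 0))"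

lemma row_sum_two_column:
  "row_sum (two_column_matrix j \<alpha> \<beta>) i' j' = \<alpha> i' + (if j \<le> j' then \<beta> i' else 0)"
  by (simp add: row_sum_def two_column_matrix_def sum.distrib)

lemma col_sum_two_column:
  "col_sum (two_column_matrix j \<alpha> \<beta>) i' j' =
     (if j' = Min UNIV then (\<Sum>k\<in>{..i'}. \<alpha> k) else 0) + (if j' = j then (\<Sum>k\<in>{..i'}. \<beta> k) else 0)"
  by (simp add: col_sum_def two_column_matrix_def sum.distrib)

lemma sum_if_less:
  fixes i :: "'a::{finite,linorder}" and c :: real
  shows "(\<Sum>k\<in>{..i'}. if i < k then c else 0) = c * card {i<..i'}"
proof -
  have "(\<Sum>k\<in>{..i'}. if i < k then c else 0) = (\<Sum>k\<in>{..i'} \<inter> {k. i < k}. c)"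
    by (simp add: sum.If_cases)
  also have "{..i'} \<inter> {k. i < k} = {i<..i'}" by auto
  finally show ?thesis by simp
qed

lemma card_greaterThanAtMost_less:
  fixes i :: "'a::{finite,linorder}"
  shows "card {i<..i'} < CARD('a)"
  by (intro psubset_card_mono) auto

lemma card_greaterThanAtMost_pos:
  fixes i :: "'a::{finite,linorder}"
  shows "i < i' \<Longrightarrow> 1 \<le> card {i<..i'}"
  by (simp add: Suc_le_eq card_gt_0_iff)

text \<open>In the violating matrices below, the spread over all rows (or columns) past \<open>i\<close> (or \<open>j\<close>) only
  serves to compensate the bad entry without referring to a successor index.\<close>

lemma violating_row_sum:
  fixes i :: "'m::{finite,linorder}" and j :: "'n::{finite,linorder}"
  assumes "i \<noteq> Min UNIV"
  obtains w :: "real ^ 'n::{finite,linorder} ^ 'm::{finite,linorder}"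
  where "row_sum w i j < 0" "\<And>i' j'. (i', j') \<noteq> (i, j) \<Longrightarrow> 0 \<le> row_sum w i' j'"
    "\<And>i' j'. 0 \<le> col_sum w i' j'" "\<And>i' j'. col_sum w i' j' \<le> 1"
proof -
  \<comment> \<open>The entry -1/2 at \<open>j\<close> makes one row sum negative and each later
    column repays 1/2. A first row of constant value 1/2 keeps the column sums between 0 and
    1.\<close>
  define v :: "'n \<Rightarrow> real" where "v j' = (if j' = j then - 1 / 2 else 0) + (if j < j' then 1 / 2 else 0)" for j'
  define w :: "real ^ 'n::{finite,linorder} ^ 'm::{finite,linorder}"
    where "w = (\<chi> i' j'. (if i' = Min UNIV then 1 / 2 else 0) + (if i' = i then v j' else 0))"
  have row: "row_sum w i' j' = (if i' = Min UNIV then card {..j'} / 2 else 0)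
      + (if i' = i then (if j \<le> j' then (real (card {j<..j'}) - 1) / 2 else 0) else 0)" for i' j'
    by (auto simp: row_sum_def w_def sum.distrib v_def sum_if_less diff_divide_distrib)
  have col: "col_sum w i' j' = 1 / 2 + (if i \<le> i' then v j' else 0)" for i' j'
    by (simp add: col_sum_def w_def sum.distrib)
  show ?thesis
  proof
    show "row_sum w i j < 0" using assms by (simp add: row)
    show "0 \<le> row_sum w i' j'" if "(i', j') \<noteq> (i, j)" for i' j'
      using assms that card_greaterThanAtMost_pos[of j j'] by (auto simp: row)
  qed (auto simp: col v_def)
qed

text \<open>Column \<open>j\<close> has \<open>- t\<close> in row \<open>i\<close> and
  \<open>t\<close> in every later row, so only its sum at \<open>i\<close> is negative. An entry
  \<open>t\<close> in row \<open>i\<close> of the first column offsets the negative entry in the row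
  sums.\<close>

lemma violating_col_sum_lower:
  fixes i :: "'m::{finite,linorder}" and j :: "'n::{finite,linorder}"
  assumes "j \<noteq> Min UNIV"
  obtains w :: "real ^ 'n::{finite,linorder} ^ 'm::{finite,linorder}"
  where "col_sum w i j < 0" "\<And>i' j'. (i', j') \<noteq> (i, j) \<Longrightarrow> 0 \<le> col_sum w i' j'"
    "\<And>i' j'. 0 \<le> row_sum w i' j'" "\<And>i' j'. col_sum w i' j' \<le> 1"
proof -
  \<comment> \<open>Small enough that adding \<open>t\<close> over all later rows stays at most
    1.\<close>
  define t :: real where "t = 1 / CARD('m)"
  have t: "0 < t" by (simp add: t_def)
  define w :: "real ^ 'n::{finite,linorder} ^ 'm::{finite,linorder}"
    where "w = two_column_matrix j (\<lambda>k. if k = i then t else 0)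
      (\<lambda>k. (if k = i then - t else 0) + (if i < k then t else 0))"
  have row: "row_sum w i' j' = (if i' = i then t else 0)
      + (if j \<le> j' then (if i' = i then - t else 0) + (if i < i' then t else 0) else 0)" for i' j'
    by (simp add: w_def row_sum_two_column)
  have col: "col_sum w i' j' = (if j' = Min UNIV then (if i \<le> i' then t else 0) else 0)
      + (if j' = j then (if i \<le> i' then t * (real (card {i<..i'}) - 1) else 0) else 0)" for i' j'
    by (auto simp: w_def col_sum_two_column sum.distrib sum_if_less algebra_simps)
  have t1: "t \<le> 1" by (simp add: t_def Suc_le_eq)
  have le: "t * (real (card {i<..i'}) - 1) \<le> 1" for i'
    using card_greaterThanAtMost_less[of i i'] by (simp add: t_def divide_simps)
  show ?thesis
  proof
    show "col_sum w i j < 0" using assms t by (simp add: col)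
    show "0 \<le> col_sum w i' j'" if "(i', j') \<noteq> (i, j)" for i' j'
      using assms that t card_greaterThanAtMost_pos[of i i'] by (auto simp: col)
    show "0 \<le> row_sum w i' j'" for i' j' using t by (auto simp: row)
    show "col_sum w i' j' \<le> 1" for i' j' using assms t1 le[of i'] by (auto simp: col)
  qed
qed

text \<open>Column \<open>j\<close> jumps to \<open>1 + t\<close> in row \<open>i\<close> and loses
  \<open>t\<close> in every later row, so its sum exceeds 1 only at \<open>i\<close>. The first
  column has \<open>t\<close> in the later rows to pay for these losses in the row sums.\<close>

lemma violating_col_sum_upper:
  fixes i :: "'m::{finite,linorder}" and j :: "'n::{finite,linorder}"
  assumes "j \<noteq> Min UNIV"
  obtains w :: "real ^ 'n::{finite,linorder} ^ 'm::{finite,linorder}"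
  where "1 < col_sum w i j" "\<And>i' j'. (i', j') \<noteq> (i, j) \<Longrightarrow> col_sum w i' j' \<le> 1"
    "\<And>i' j'. 0 \<le> row_sum w i' j'" "\<And>i' j'. 0 \<le> col_sum w i' j'"
proof -
  \<comment> \<open>Keeps the first column's sums at most 1 and prevents the losses in column
    \<open>j\<close> from driving its sums below 0.\<close>
  define t :: real where "t = 1 / CARD('m)"
  have t: "0 < t" by (simp add: t_def)
  define w :: "real ^ 'n::{finite,linorder} ^ 'm::{finite,linorder}"
    where "w = two_column_matrix j (\<lambda>k. if i < k then t else 0)
      (\<lambda>k. (if k = i then 1 + t else 0) + (if i < k then - t else 0))"
  have row: "row_sum w i' j' = (if i < i' then t else 0)
      + (if j \<le> j' then (if i' = i then 1 + t else 0) + (if i < i' then - t else 0) else 0)" for i' j'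
    by (simp add: w_def row_sum_two_column)
  have col: "col_sum w i' j' = (if j' = Min UNIV then t * card {i<..i'} else 0)
      + (if j' = j then (if i \<le> i' then 1 + t - t * card {i<..i'} else 0) else 0)" for i' j'
    by (auto simp: w_def col_sum_two_column sum.distrib sum_if_less algebra_simps)
  have le: "t * card {i<..i'} \<le> 1" for i'
    using card_greaterThanAtMost_less[of i i'] by (simp add: t_def divide_simps)
  have ge: "t \<le> t * card {i<..i'}" if "i < i'" for i'
    using card_greaterThanAtMost_pos[OF that] t by simp
  show ?thesis
  proof
    show "1 < col_sum w i j" using assms t by (simp add: col)
    show "col_sum w i' j' \<le> 1" if "(i', j') \<noteq> (i, j)" for i' j'
      using assms that t le[of i'] ge[of i'] by (auto simp: col)
    show "0 \<le> row_sum w i' j'" for i' j' using t by (auto simp: row)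
    show "0 \<le> col_sum w i' j'" for i' j' using assms t le[of i'] by (auto simp: col)
  qed
qed

text \<open>Serves the two bounds kept in the first column, which the two-column matrices do not
  reach.\<close>

definition corner_matrix ::
  "'m \<Rightarrow> real \<Rightarrow> real ^ 'n::{finite,linorder} ^ 'm::{finite,linorder}" where
  "corner_matrix i c = (\<chi> i' j'. if i' = i \<and> j' = Min UNIV then c else 0)"

lemma row_sum_corner: "row_sum (corner_matrix i c) i' j' = (if i' = i then c else 0)"
  by (auto simp: row_sum_def corner_matrix_def)

lemma col_sum_corner:
  "col_sum (corner_matrix i c) i' j' = (if i \<le> i' \<and> j' = Min UNIV then c else 0)"
  by (cases "j' = Min UNIV") (simp_all add: col_sum_def corner_matrix_def)

section \<open>An interior point and the reduced system of inequalities\<close>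

lemma strict_interior_point:
  obtains z :: "real ^ 'n::{finite,linorder} ^ 'm::{finite,linorder}"
  where "\<And>i j. 0 < row_sum z i j" "\<And>i j. 0 < col_sum z i j" "\<And>i j. col_sum z i j < 1"
proof -
  \<comment> \<open>The extra 1 keeps even the full column sum strictly below 1.\<close>
  define t :: real where "t = 1 / (CARD('m) + 1)"
  define z :: "real ^ 'n::{finite,linorder} ^ 'm::{finite,linorder}" where "z = (\<chi> i j. t)"
  have t: "0 < t" by (simp add: t_def)
  have "real (card {..i}) < CARD('m) + 1" for i :: 'm
    using card_mono[of UNIV "{..i}"] by simp
  then have "card {..i} * t < 1" for i :: 'm
    by (simp add: t_def divide_simps)
  moreover have "0 < card {..i}" "0 < card {..j}" for i :: 'm and j :: 'n
    by (auto simp: card_gt_0_iff)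
  ultimately show ?thesis
    using t by (intro that[of z]) (simp_all add: row_sum_def col_sum_def z_def)
qed

text \<open>A row sum in the first row is a sum of first-row column sums, hence nonnegative. The
  first entry of each row is its first row sum, so the first column has nonnegative entries: its
  partial sums are nonnegative and increase to the last one, the only one whose upper bound has to
  be imposed.\<close>

lemma sign_region_irredundant:
  "sign_region = {M :: real ^ 'n::{finite,linorder} ^ 'm::{finite,linorder}.
     (\<forall>i j. i \<noteq> Min UNIV \<longrightarrow> 0 \<le> row_sum M i j) \<and>
     (\<forall>i j. j \<noteq> Min UNIV \<or> i = Min UNIV \<longrightarrow> 0 \<le> col_sum M i j) \<and>
     (\<forall>i j. j \<noteq> Min UNIV \<or> i = Max UNIV \<longrightarrow> col_sum M i j \<le> 1)}"
  (is "_ = {M. ?P M}")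
proof (intro equalityI subsetI)
  fix M :: "real ^ 'n::{finite,linorder} ^ 'm::{finite,linorder}"
  assume "M \<in> {M. ?P M}"
  then have row: "\<And>i j. i \<noteq> Min UNIV \<Longrightarrow> 0 \<le> row_sum M i j"
    and lo: "\<And>i j. j \<noteq> Min UNIV \<or> i = Min UNIV \<Longrightarrow> 0 \<le> col_sum M i j"
    and up: "\<And>i j. j \<noteq> Min UNIV \<or> i = Max UNIV \<Longrightarrow> col_sum M i j \<le> 1"
    by blast+
  have atMost_Min: "{..Min (UNIV :: 'a::{finite,linorder} set)} = {Min UNIV}"
    by (auto intro!: antisym)
  have row': "0 \<le> row_sum M i j" for i j
  proof (cases "i = Min UNIV")
    case True
    then have "row_sum M i j = (\<Sum>j'\<in>{..j}. col_sum M i j')"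
      by (simp add: row_sum_def col_sum_def atMost_Min)
    then show ?thesis using True lo by (simp add: sum_nonneg)
  qed (rule row)
  have entry: "0 \<le> M $ i $ Min UNIV" for i
    using row'[of i "Min UNIV"] by (simp add: row_sum_def atMost_Min)
  have lo': "0 \<le> col_sum M i j" for i j
    using lo[of j i] entry by (cases "j = Min UNIV") (auto simp: col_sum_def intro!: sum_nonneg)
  have up': "col_sum M i j \<le> 1" for i j
  proof (cases "j = Min UNIV")
    case True
    have "col_sum M i j \<le> col_sum M (Max UNIV) j"
      unfolding col_sum_def True by (rule sum_mono2) (auto simp: entry intro: order_trans)
    then show ?thesis using up[of j "Max UNIV"] by simp
  qed (simp add: up)
  show "M \<in> sign_region" using row' lo' up' by (simp add: sign_region_def)
qed (auto simp: sign_region_def)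

section \<open>Assembling and counting the irredundant inequalities\<close>

theorem theorem6p1:
  fixes m n :: nat
  assumes "CARD('m::{finite,linorder}) = m" and "CARD('n::{finite,linorder}) = n"
  shows "int (card {F. F facet_of (sign_matrix_polytope :: (real ^ 'n::{finite,linorder} ^ 'm::{finite,linorder}) set)})
           = 3 * int m * int n - int n - 2 * (int m - 1)"
proof -
  define A :: "('m \<times> 'n) set" where "A = (UNIV - {Min UNIV}) \<times> UNIV"
  define B :: "('m \<times> 'n) set" where "B = UNIV \<times> (UNIV - {Min UNIV}) \<union> {(Min UNIV, Min UNIV)}"
  define D :: "('m \<times> 'n) set" where "D = UNIV \<times> (UNIV - {Min UNIV}) \<union> {(Max UNIV, Min UNIV)}"
  \<comment> \<open>A disjoint sum, since one position may index a row bound, a lower and an upper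
    column bound at once.\<close>
  define K where "K = A <+> (B <+> D)"
  define f :: "('m \<times> 'n) + ('m \<times> 'n) + ('m \<times> 'n) \<Rightarrow> (real ^ 'n::{finite,linorder} ^ 'm::{finite,linorder}) \<Rightarrow> real" where
    "f = case_sum (\<lambda>(i, j) M. - row_sum M i j)
       (case_sum (\<lambda>(i, j) M. - col_sum M i j) (\<lambda>(i, j) M. col_sum M i j))"
  define b :: "('m \<times> 'n) + ('m \<times> 'n) + ('m \<times> 'n) \<Rightarrow> real" where
    "b = case_sum (\<lambda>_. 0) (case_sum (\<lambda>_. 0) (\<lambda>_. 1))"
  have mem: "(i, j) \<in> A \<longleftrightarrow> i \<noteq> Min UNIV" "(i, j) \<in> B \<longleftrightarrow> j \<noteq> Min UNIV \<or> i = Min UNIV"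
      "(i, j) \<in> D \<longleftrightarrow> j \<noteq> Min UNIV \<or> i = Max UNIV" for i j
    by (auto simp: A_def B_def D_def)
  have ball_K: "(\<forall>k\<in>K. Q k) \<longleftrightarrow>
      (\<forall>i j. (i, j) \<in> A \<longrightarrow> Q (Inl (i, j))) \<and> (\<forall>i j. (i, j) \<in> B \<longrightarrow> Q (Inr (Inl (i, j)))) \<and>
      (\<forall>i j. (i, j) \<in> D \<longrightarrow> Q (Inr (Inr (i, j))))" for Q
    by (auto simp: K_def)
  have "sign_matrix_polytope = {M. \<forall>k\<in>K. f k M \<le> b k}"
    unfolding sign_matrix_polytope_eq sign_region_irredundant ball_K mem
    by (simp add: f_def b_def)
  moreover have "card {F. F facet_of {M. \<forall>k\<in>K. f k M \<le> b k}} = card K"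
  proof -
    obtain z :: "real ^ 'n::{finite,linorder} ^ 'm::{finite,linorder}"
      where z: "\<And>i j. 0 < row_sum z i j" "\<And>i j. 0 < col_sum z i j" "\<And>i j. col_sum z i j < 1"
      using strict_interior_point by blast
    show ?thesis
    proof (rule card_facets_irredundant)
      show "finite K" by (simp add: K_def A_def B_def D_def)
      show "linear (f k)" if "k \<in> K" for k
        using that
        by (auto simp: K_def f_def intro: linear_compose_neg[OF linear_row_sum]
            linear_compose_neg[OF linear_col_sum] linear_col_sum)
      show "f k z < b k" if "k \<in> K" for k
        using that by (auto simp: K_def f_def b_def z)
      show "\<exists>w. b k < f k w \<and> (\<forall>l\<in>K - {k}. f l w \<le> b l)" if k: "k \<in> K" for k
      proof -
        consider (A) i j where "k = Inl (i, j)" "i \<noteq> Min UNIV"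
          | (B) i j where "k = Inr (Inl (i, j))" "j \<noteq> Min UNIV"
          | (B') "k = Inr (Inl (Min UNIV, Min UNIV))"
          | (D) i j where "k = Inr (Inr (i, j))" "j \<noteq> Min UNIV"
          | (D') "k = Inr (Inr (Max UNIV, Min UNIV))"
          using k unfolding K_def A_def B_def D_def by blast
        then show ?thesis
        proof cases
          case A
          obtain w :: "real ^ 'n::{finite,linorder} ^ 'm::{finite,linorder}"
            where "row_sum w i j < 0" "\<And>i' j'. (i', j') \<noteq> (i, j) \<Longrightarrow> 0 \<le> row_sum w i' j'"
              "\<And>i' j'. 0 \<le> col_sum w i' j'" "\<And>i' j'. col_sum w i' j' \<le> 1"
            using violating_row_sum[OF A(2), of j] by blast
          note w = this
          have "\<forall>l\<in>K. l \<noteq> k \<longrightarrow> f l w \<le> b l"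
            unfolding ball_K A(1) by (simp add: f_def b_def w)
          moreover have "b k < f k w"
            using w(1) by (simp add: A(1) f_def b_def)
          ultimately show ?thesis by blast
        next
          case B
          obtain w :: "real ^ 'n::{finite,linorder} ^ 'm::{finite,linorder}"
            where "col_sum w i j < 0" "\<And>i' j'. (i', j') \<noteq> (i, j) \<Longrightarrow> 0 \<le> col_sum w i' j'"
              "\<And>i' j'. 0 \<le> row_sum w i' j'" "\<And>i' j'. col_sum w i' j' \<le> 1"
            using violating_col_sum_lower[OF B(2), of i] by blast
          note w = this
          have "\<forall>l\<in>K. l \<noteq> k \<longrightarrow> f l w \<le> b l"
            unfolding ball_K B(1) by (simp add: f_def b_def w)
          moreover have "b k < f k w"
            using w(1) by (simp add: B(1) f_def b_def)
          ultimately show ?thesis by blast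
        next
          case B'
          \<comment> \<open>The other sums that become negative lie in the first row or the first
            column, and their lower bounds are not in \<open>K\<close>.\<close>
          let ?w = "corner_matrix (Min UNIV) (- 1) :: real ^ 'n::{finite,linorder} ^ 'm::{finite,linorder}"
          have "\<forall>l\<in>K. l \<noteq> k \<longrightarrow> f l ?w \<le> b l"
            unfolding ball_K mem B' by (auto simp: f_def b_def row_sum_corner col_sum_corner)
          moreover have "b k < f k ?w"
            by (simp add: B' f_def b_def row_sum_corner col_sum_corner)
          ultimately show ?thesis by blast
        next
          case D
          obtain w :: "real ^ 'n::{finite,linorder} ^ 'm::{finite,linorder}"
            where "1 < col_sum w i j" "\<And>i' j'. (i', j') \<noteq> (i, j) \<Longrightarrow> col_sum w i' j' \<le> 1"
              "\<And>i' j'. 0 \<le> row_sum w i' j'" "\<And>i' j'. 0 \<le> col_sum w i' j'"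
            using violating_col_sum_upper[OF D(2), of i] by blast
          note w = this
          have "\<forall>l\<in>K. l \<noteq> k \<longrightarrow> f l w \<le> b l"
            unfolding ball_K D(1) by (simp add: f_def b_def w)
          moreover have "b k < f k w"
            using w(1) by (simp add: D(1) f_def b_def)
          ultimately show ?thesis by blast
        next
          case D'
          \<comment> \<open>Placed in the last row, the entry 2 enters only one column partial
            sum.\<close>
          let ?w = "corner_matrix (Max UNIV) 2 :: real ^ 'n::{finite,linorder} ^ 'm::{finite,linorder}"
          have max: "(\<forall>a. a \<le> i) \<longleftrightarrow> i = Max UNIV" for i :: 'm
            by (auto intro: antisym)
          have "\<forall>l\<in>K. l \<noteq> k \<longrightarrow> f l ?w \<le> b l"
            unfolding ball_K mem D' by (auto simp: f_def b_def row_sum_corner col_sum_corner max)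
          moreover have "b k < f k ?w"
            by (simp add: D' f_def b_def row_sum_corner col_sum_corner)
          ultimately show ?thesis by blast
        qed
      qed
    qed
  qed
  moreover have "int (card K) = 3 * int m * int n - int n - 2 * (int m - 1)"
  proof -
    \<comment> \<open>Makes the truncated subtractions \<open>m - 1\<close> and \<open>n - 1\<close>
      exact when passing to integers.\<close>
    have mn: "1 \<le> m" "1 \<le> n" using assms by (auto simp: Suc_le_eq)
    have cA: "card A = (m - 1) * n"
      by (simp add: A_def card_cartesian_product card_Diff_subset assms)
    have cB: "card B = m * (n - 1) + 1"
      unfolding B_def
      by (subst card_Un_disjoint) (auto simp: card_cartesian_product card_Diff_subset assms)
    have cD: "card D = m * (n - 1) + 1"
      unfolding D_def
      by (subst card_Un_disjoint) (auto simp: card_cartesian_product card_Diff_subset assms)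
    have "card K = card A + (card B + card D)"
      unfolding K_def by (simp add: card_Plus A_def B_def D_def)
    then show ?thesis
      using mn by (simp only: cA cB cD of_nat_add of_nat_mult of_nat_diff of_nat_1) (simp add: algebra_simps)
  qed
  ultimately show ?thesis by simp
qed

end
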